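(* Let $\mathcal{H}_2$ be the class of $2$-vertex extremal minimal bipartite matching covered graphs and $\mathcal{H}_3$ the class of $2$-vertex $n$-extremal minimal bipartite matching covered graphs. Then $\mathcal{H}_3\subset\mathcal{H}_2$ (a proper containment).
   Context: All graphs are finite and loopless; parallel edges are allowed. For a graph $G=(V,E)$ write $n=|V|$ and $m=|E|$. A connected graph on four or more vertices is matching covered if every edge lies in some perfect matching. A matching covered graph is minimal if deleting any single edge yields a graph that is not matching covered. $V_2$ is the set of vertices of degree two. A minimal bipartite matching covered graph is $2$-vertex extremal if $|V_2|=2(m-n+2)$, and $2$-vertex $n$-extremal if $|V_2|=\frac n2+2$. Classes are regarded up to isomorphism. *)

theory Defs
  imports Complex_Main
begin

text \<open>Undirected multigraphs. Edges have their own identity, so parallel edges are allowed; every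
  edge has exactly two ends, so loops are not. The value of the end map outside the edge set is
  irrelevant, and isomorphism ignores it.\<close>

record ('v, 'e) mgraph =
  verts :: "'v set"
  edges :: "'e set"
  ends  :: "'e \<Rightarrow> 'v set"

definition multigraph :: "('v, 'e) mgraph \<Rightarrow> bool" where
  "multigraph G \<longleftrightarrow> finite (verts G) \<and> finite (edges G) \<and>
     (\<forall>e\<in>edges G. ends G e \<subseteq> verts G \<and> card (ends G e) = 2)"

definition adj :: "('v, 'e) mgraph \<Rightarrow> ('v \<times> 'v) set" where
  "adj G = {(u, v). \<exists>e\<in>edges G. ends G e = {u, v}}"

definition connected_graph :: "('v, 'e) mgraph \<Rightarrow> bool" where
  "connected_graph G \<longleftrightarrow> verts G \<noteq> {} \<and> (\<forall>u\<in>verts G. \<forall>v\<in>verts G. (u, v) \<in> (adj G)\<^sup>*)"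

definition bipartite :: "('v, 'e) mgraph \<Rightarrow> bool" where
  "bipartite G \<longleftrightarrow> (\<exists>A B. A \<union> B = verts G \<and> A \<inter> B = {} \<and>
     (\<forall>e\<in>edges G. \<exists>a\<in>A. \<exists>b\<in>B. ends G e = {a, b}))"

definition degree :: "('v, 'e) mgraph \<Rightarrow> 'v \<Rightarrow> nat" where
  "degree G v = card {e \<in> edges G. v \<in> ends G e}"

definition V2 :: "('v, 'e) mgraph \<Rightarrow> 'v set" where
  "V2 G = {v \<in> verts G. degree G v = 2}"

definition perfect_matching :: "('v, 'e) mgraph \<Rightarrow> 'e set \<Rightarrow> bool" where
  "perfect_matching G M \<longleftrightarrow> M \<subseteq> edges G \<and> (\<forall>v\<in>verts G. \<exists>!e. e \<in> M \<and> v \<in> ends G e)"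

definition matching_covered :: "('v, 'e) mgraph \<Rightarrow> bool" where
  "matching_covered G \<longleftrightarrow> multigraph G \<and> connected_graph G \<and> card (verts G) \<ge> 4 \<and>
     (\<forall>e\<in>edges G. \<exists>M. perfect_matching G M \<and> e \<in> M)"

definition delete_edge :: "('v, 'e) mgraph \<Rightarrow> 'e \<Rightarrow> ('v, 'e) mgraph" where
  "delete_edge G e = G\<lparr>edges := edges G - {e}\<rparr>"

definition minimal_matching_covered :: "('v, 'e) mgraph \<Rightarrow> bool" where
  "minimal_matching_covered G \<longleftrightarrow> matching_covered G \<and>
     (\<forall>e\<in>edges G. \<not> matching_covered (delete_edge G e))"

definition two_vertex_extremal :: "('v, 'e) mgraph \<Rightarrow> bool" where
  "two_vertex_extremal G \<longleftrightarrow>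
     int (card (V2 G)) = 2 * (int (card (edges G)) - int (card (verts G)) + 2)"

definition two_vertex_n_extremal :: "('v, 'e) mgraph \<Rightarrow> bool" where
  "two_vertex_n_extremal G \<longleftrightarrow> real (card (V2 G)) = real (card (verts G)) / 2 + 2"

definition isomorphic :: "('v, 'e) mgraph \<Rightarrow> ('w, 'f) mgraph \<Rightarrow> bool" where
  "isomorphic G H \<longleftrightarrow> (\<exists>f g. bij_betw f (verts G) (verts H) \<and> bij_betw g (edges G) (edges H) \<and>
     (\<forall>e\<in>edges G. ends H (g e) = f ` ends G e))"

text \<open>Classes of graphs up to isomorphism are sets of isomorphism classes of multigraphs whose
  vertices and edges are natural numbers. No finite graph is lost this way, see
  \<open>ex_isomorphic_nat\<close> below.\<close>

definition iso_rel :: "((nat, nat) mgraph \<times> (nat, nat) mgraph) set" where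
  "iso_rel = {(G, H). multigraph G \<and> multigraph H \<and> isomorphic G H}"

definition class_H2 :: "(nat, nat) mgraph set set" where
  "class_H2 =
     {G. minimal_matching_covered G \<and> bipartite G \<and> two_vertex_extremal G} // iso_rel"

definition class_H3 :: "(nat, nat) mgraph set set" where
  "class_H3 =
     {G. minimal_matching_covered G \<and> bipartite G \<and> two_vertex_n_extremal G} // iso_rel"

lemma ex_isomorphic_nat:
  fixes G :: "('v, 'e) mgraph"
  assumes "multigraph G"
  shows "\<exists>H :: (nat, nat) mgraph. multigraph H \<and> isomorphic G H"
proof -
  have fin: "finite (verts G)" "finite (edges G)"
    and ends: "\<And>e. e \<in> edges G \<Longrightarrow> ends G e \<subseteq> verts G \<and> card (ends G e) = 2"
    using assms by (simp_all add: multigraph_def)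
  obtain f :: "'v \<Rightarrow> nat" where f: "inj_on f (verts G)"
    using finite_imp_inj_to_nat_seg[OF fin(1)] by blast
  obtain g :: "'e \<Rightarrow> nat" where g: "inj_on g (edges G)"
    using finite_imp_inj_to_nat_seg[OF fin(2)] by blast
  define H where "H = \<lparr>verts = f ` verts G, edges = g ` edges G,
    ends = (\<lambda>k. f ` ends G (the_inv_into (edges G) g k))\<rparr>"
  have "card (f ` ends G e) = 2" if "e \<in> edges G" for e
    using ends[OF that] card_image[OF inj_on_subset[OF f]] by simp
  then have "multigraph H"
    using fin ends by (simp add: multigraph_def H_def the_inv_into_f_f[OF g] image_mono)
  moreover have "isomorphic G H"
    unfolding isomorphic_def
    by (rule exI[of _ f], rule exI[of _ g])
      (simp add: H_def bij_betw_def f g the_inv_into_f_f[OF g])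
  ultimately show ?thesis by blast
qed

lemma isomorphicE:
  assumes "isomorphic G H"
  obtains f g where "bij_betw f (verts G) (verts H)" "bij_betw g (edges G) (edges H)"
    "\<forall>e\<in>edges G. ends H (g e) = f ` ends G e"
  using assms unfolding isomorphic_def by blast

lemma isomorphicI:
  assumes "bij_betw f (verts G) (verts H)" "bij_betw g (edges G) (edges H)"
    "\<And>e. e \<in> edges G \<Longrightarrow> ends H (g e) = f ` ends G e"
  shows "isomorphic G H"
  unfolding isomorphic_def using assms by (intro exI conjI ballI)

lemma equiv_iso_rel: "equiv (Collect multigraph) iso_rel"
proof (rule equivI)
  show "iso_rel \<subseteq> Collect multigraph \<times> Collect multigraph"
    by (auto simp: iso_rel_def)
  have "isomorphic G G" for G :: "(nat, nat) mgraph"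
    unfolding isomorphic_def by (rule exI[of _ id], rule exI[of _ id]) simp
  then show "refl_on (Collect multigraph) iso_rel"
    by (auto simp: refl_on_def iso_rel_def)
  have "isomorphic H G" if G: "multigraph G" and "isomorphic G H" for G H :: "(nat, nat) mgraph"
  proof -
    from \<open>isomorphic G H\<close> obtain f g where f: "bij_betw f (verts G) (verts H)"
      and g: "bij_betw g (edges G) (edges H)"
      and fg: "\<forall>e\<in>edges G. ends H (g e) = f ` ends G e"
      by (rule isomorphicE)
    let ?f = "the_inv_into (verts G) f" and ?g = "the_inv_into (edges G) g"
    have "ends G (?g k) = ?f ` ends H k" if k: "k \<in> edges H" for k
    proof -
      obtain e where e: "e \<in> edges G" "k = g e"
        using k bij_betw_imp_surj_on[OF g] by blast
      have sub: "ends G e \<subseteq> verts G" using G e(1) by (simp add: multigraph_def)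
      have "?f (f x) = x" if "x \<in> ends G e" for x
        by (rule the_inv_into_f_f[OF bij_betw_imp_inj_on[OF f] subsetD[OF sub that]])
      then have "?f ` f ` ends G e = ends G e" by (simp add: image_image cong: image_cong)
      moreover have "?g k = e"
        unfolding e(2) by (rule the_inv_into_f_f[OF bij_betw_imp_inj_on[OF g] e(1)])
      moreover have "ends H k = f ` ends G e" unfolding e(2) by (rule bspec[OF fg e(1)])
      ultimately show ?thesis by (simp only:)
    qed
    then show "isomorphic H G"
      by (rule isomorphicI[OF bij_betw_the_inv_into[OF f] bij_betw_the_inv_into[OF g]])
  qed
  then show "sym iso_rel" unfolding sym_def iso_rel_def by blast
  have "isomorphic G K" if "isomorphic G H" "isomorphic H K" for G H K :: "(nat, nat) mgraph"
  proof -
    obtain f g where 1: "bij_betw f (verts G) (verts H)" "bij_betw g (edges G) (edges H)"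
      "\<forall>e\<in>edges G. ends H (g e) = f ` ends G e"
      using \<open>isomorphic G H\<close> by (rule isomorphicE)
    obtain f' g' where 2: "bij_betw f' (verts H) (verts K)" "bij_betw g' (edges H) (edges K)"
      "\<forall>e\<in>edges H. ends K (g' e) = f' ` ends H e"
      using \<open>isomorphic H K\<close> by (rule isomorphicE)
    have "ends K ((g' \<circ> g) e) = (f' \<circ> f) ` ends G e" if "e \<in> edges G" for e
      using bspec[OF 1(3) that] bspec[OF 2(3) bij_betwE[OF 1(2), rule_format, OF that]]
      by (simp add: image_comp)
    then show ?thesis
      by (rule isomorphicI[OF bij_betw_trans[OF 1(1) 2(1)] bij_betw_trans[OF 1(2) 2(2)]])
  qed
  then show "trans iso_rel" unfolding trans_def iso_rel_def by blast
qed

end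

theory Submission imports Defs begin

text \<open>Let \<open>A\<close>, \<open>B\<close> be the colour classes and write \<open>N X\<close> for the neighbourhood of \<open>X\<close>. By Hall's theorem the
  graph is matching covered iff \<open>|N X| > |X|\<close> for all nonempty proper \<open>X \<subset> A\<close>. In a minimal graph every
  edge \<open>ab\<close> therefore has a tight set: a proper \<open>X \<subset> A\<close> with \<open>|N X| = |X| + 1\<close> in which \<open>a\<close> is the only
  neighbour of \<open>b\<close>. Uncrossing tight sets shows that no cycle has all of its \<open>A\<close>-vertices, except
  possibly one, of degree at least three. So each vertex of \<open>A\<close> has its neighbours in different
  components of the hypergraph on \<open>B\<close> formed by the neighbourhoods of the other vertices of degree
  at least three. Counting components gives at least \<open>m - n + 2\<close> vertices of degree two in \<open>A\<close>, and
  likewise in \<open>B\<close>, so \<open>|V\<^sub>2| \<ge> 2(m - n + 2)\<close>. Adding \<open>|V\<^sub>2| \<ge> 3n - 2m\<close>, the degree sum bound, yields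
  \<open>|V\<^sub>2| \<ge> n/2 + 2\<close>, and equality here forces equality in both. The containment is proper because of
  the graph formed by four paths of length three with common ends.\<close>

section \<open>Hall's marriage theorem\<close>

text \<open>Rado's argument: a set with two elements can lose one of them without violating Hall's
  condition, since two violations contradict submodularity.\<close>
lemma hall_marriage:
  fixes F :: "'i \<Rightarrow> 'v set"
  assumes "finite I" "\<And>i. i \<in> I \<Longrightarrow> finite (F i)"
    and "\<And>J. J \<subseteq> I \<Longrightarrow> card J \<le> card (\<Union>(F ` J))"
  shows "\<exists>R. inj_on R I \<and> (\<forall>i\<in>I. R i \<in> F i)"
  using assms
proof (induction "\<Sum>i\<in>I. card (F i)" arbitrary: F rule: less_induct)
  case less
  note finI = less.prems(1) and finF = less.prems(2) and cond = less.prems(3)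
  have ne: "F i \<noteq> {}" if "i \<in> I" for i
    using cond[of "{i}"] that by auto
  show ?case
  proof (cases "\<exists>i\<in>I. \<exists>x\<in>F i. \<exists>y\<in>F i. x \<noteq> y")
    case False
    define R where "R i = (SOME x. x \<in> F i)" for i
    have R: "R i \<in> F i" if "i \<in> I" for i
      using ne[OF that] some_in_eq R_def by metis
    have single: "F i = {R i}" if "i \<in> I" for i
      using False R[OF that] that by blast
    have "inj_on R I"
    proof (rule inj_onI, rule ccontr)
      fix i j assume "i \<in> I" "j \<in> I" "R i = R j" "i \<noteq> j"
      then show False using cond[of "{i, j}"] single by auto
    qed
    with R show ?thesis by blast
  next
    case True
    then obtain i x y where i: "i \<in> I" and xy: "x \<in> F i" "y \<in> F i" "x \<noteq> y" by blast
    define Fz where "Fz z = F(i := F i - {z})" for z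
    have fz: "finite (Fz z j)" if "j \<in> I" for z j
      using finF[OF that] finF[OF i] by (simp add: Fz_def)
    have dec: "(\<Sum>j\<in>I. card (Fz z j)) < (\<Sum>j\<in>I. card (F j))" if "z \<in> F i" for z
    proof (rule sum_strict_mono_ex1)
      show "\<forall>j\<in>I. card (Fz z j) \<le> card (F j)"
        using finF by (auto simp: Fz_def intro: card_mono)
      show "\<exists>j\<in>I. card (Fz z j) < card (F j)"
        using i that finF[OF i] by (intro bexI[of _ i]) (metis Fz_def card_Diff1_less fun_upd_same)
    qed (rule finI)
    have sub: "\<exists>R. inj_on R I \<and> (\<forall>j\<in>I. R j \<in> F j)"
      if z: "z \<in> F i" and h: "\<And>J. J \<subseteq> I \<Longrightarrow> card J \<le> card (\<Union>(Fz z ` J))" for z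
    proof -
      obtain R where "inj_on R I" "\<forall>j\<in>I. R j \<in> Fz z j"
        using less.hyps[OF dec[OF z] finI fz h] by blast
      moreover have "Fz z j \<subseteq> F j" for j by (auto simp: Fz_def)
      ultimately show ?thesis by blast
    qed
    \<comment> \<open>A violating family must contain \<open>i\<close>, the only index whose set has
      changed. Taking \<open>i\<close> out of it lowers its size by one, so the strict violation
      becomes the weak inequality used here.\<close>
    have split: "\<exists>J. J \<subseteq> I - {i} \<and> card (\<Union>(F ` J) \<union> (F i - {z})) \<le> card J"
      if bad: "\<not> (\<forall>J. J \<subseteq> I \<longrightarrow> card J \<le> card (\<Union>(Fz z ` J)))" for z
    proof -
      obtain J where J: "J \<subseteq> I" "card (\<Union>(Fz z ` J)) < card J" using bad by (auto simp: not_le)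
      have iJ: "i \<in> J"
      proof (rule ccontr)
        assume "i \<notin> J"
        then have "\<Union>(Fz z ` J) = \<Union>(F ` J)" by (auto simp: Fz_def)
        then show False using J cond[OF J(1)] by simp
      qed
      have "\<Union>(Fz z ` J) = \<Union>(F ` (J - {i})) \<union> (F i - {z})"
        using iJ by (auto simp: Fz_def split: if_splits)
      moreover have "card J = Suc (card (J - {i}))"
        using iJ finite_subset[OF J(1) finI] by (metis card_Suc_Diff1)
      ultimately show ?thesis using J by (intro exI[of _ "J - {i}"]) auto
    qed
    show ?thesis
    proof (rule ccontr)
      assume no: "\<not> ?thesis"
      obtain J where J: "J \<subseteq> I - {i}" "card (\<Union>(F ` J) \<union> (F i - {x})) \<le> card J"
        using split[of x] sub[OF xy(1)] no by blast
      obtain K where K: "K \<subseteq> I - {i}" "card (\<Union>(F ` K) \<union> (F i - {y})) \<le> card K"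
        using split[of y] sub[OF xy(2)] no by blast
      let ?P = "\<Union>(F ` J) \<union> (F i - {x})" and ?Q = "\<Union>(F ` K) \<union> (F i - {y})"
      have finJK: "finite J" "finite K" using J K finI finite_subset by blast+
      have finPQ: "finite ?P" "finite ?Q" using J(1) K(1) finJK finF i by blast+
      \<comment> \<open>As \<open>x\<close> and \<open>y\<close> differ, each of the two sets
        restores the element that the other drops. Hence the union gains the index \<open>i\<close>,
        and this extra unit contradicts the sum of the two violations.\<close>
      have "\<Union>(F ` (insert i (J \<union> K))) = ?P \<union> ?Q" using xy by auto
      moreover have "card (insert i (J \<union> K)) = Suc (card (J \<union> K))"
        using J(1) K(1) finJK by (subst card_insert_disjoint) auto
      moreover have "insert i (J \<union> K) \<subseteq> I" using J(1) K(1) i by blast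
      ultimately have 1: "Suc (card (J \<union> K)) \<le> card (?P \<union> ?Q)"
        using cond[of "insert i (J \<union> K)"] by metis
      have "\<Union>(F ` (J \<inter> K)) \<subseteq> ?P \<inter> ?Q" by blast
      then have "card (\<Union>(F ` (J \<inter> K))) \<le> card (?P \<inter> ?Q)" using finPQ by (intro card_mono) auto
      moreover have "J \<inter> K \<subseteq> I" using J(1) by blast
      ultimately have 2: "card (J \<inter> K) \<le> card (?P \<inter> ?Q)"
        using cond[of "J \<inter> K"] by linarith
      show False
        using 1 2 J(2) K(2) card_Un_Int[OF finPQ] card_Un_Int[OF finJK] by linarith
    qed
  qed
qed

section \<open>Neighbourhoods with surplus\<close>

text \<open>The graph is reduced to a relation from \<open>A\<close> to \<open>B\<close>, since
  being matching covered depends only on neighbourhoods. The set \<open>A\<close> itself is excepted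
  because it has at most \<open>card B = card A\<close> neighbours; \<open>two_le\<close> stands for
  the four vertices.\<close>

locale surplus =
  fixes A B :: "'v set" and E :: "('v \<times> 'v) set"
  assumes finA: "finite A" and finB: "finite B" and E_sub: "E \<subseteq> A \<times> B"
    and card_eq: "card A = card B" and two_le: "2 \<le> card A"
    and surplus: "\<And>X. X \<subseteq> A \<Longrightarrow> X \<noteq> {} \<Longrightarrow> X \<noteq> A \<Longrightarrow> card X < card (E `` X)"
begin

lemma finite_nb: "finite (E `` X)"
  using E_sub by (intro finite_subset[OF _ finB]) blast

lemma nb_submod: "card (E `` (X \<inter> Y)) + card (E `` (X \<union> Y)) \<le> card (E `` X) + card (E `` Y)"
proof -
  have "card (E `` (X \<inter> Y)) \<le> card (E `` X \<inter> E `` Y)"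
    by (intro card_mono finite_Int) (auto simp: finite_nb)
  then show ?thesis
    using card_Un_Int[OF finite_nb finite_nb, of X Y] by (simp add: Image_Un)
qed

text \<open>A common neighbour lost in the intersection gains one unit. It makes up for the missing
  surplus when two tight sets cover all of \<open>A\<close>.\<close>

lemma nb_submod_strict:
  assumes "b \<in> E `` X" "b \<in> E `` Y" "b \<notin> E `` (X \<inter> Y)"
  shows "card (E `` (X \<inter> Y)) + card (E `` (X \<union> Y)) < card (E `` X) + card (E `` Y)"
proof -
  have "card (E `` (X \<inter> Y)) < card (E `` X \<inter> E `` Y)"
    by (intro psubset_card_mono finite_Int) (use assms in \<open>auto simp: finite_nb\<close>)
  then show ?thesis
    using card_Un_Int[OF finite_nb finite_nb, of X Y] by (simp add: Image_Un)
qed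

text \<open>A subset of \<open>A\<close> missing one vertex has at least \<open>card A\<close>
  neighbours, which is all of \<open>B\<close>. It follows that every vertex of \<open>B\<close> has
  two neighbours.\<close>

lemma nb_remove1: "E `` (A - {a}) = B"
proof (rule card_subset_eq[OF finB])
  show sub: "E `` (A - {a}) \<subseteq> B" using E_sub by blast
  have "card B \<le> card (E `` (A - {a}))"
  proof -
    obtain x where x: "x \<in> A" "a \<in> A \<longrightarrow> x = a"
      using two_le by (cases "a \<in> A") (auto simp: numeral_2_eq_2 dest!: card_le_Suc_iff[THEN iffD1])
    have c: "card A = Suc (card (A - {x}))" using x(1) finA by (metis card_Suc_Diff1)
    then have "A - {x} \<noteq> {}" using two_le by (intro notI) simp
    then have "card (A - {x}) < card (E `` (A - {x}))" using x(1) by (intro surplus) auto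
    also have "\<dots> \<le> card (E `` (A - {a}))"
      using x by (intro card_mono finite_nb) auto
    finally show ?thesis using c card_eq by simp
  qed
  then show "card (E `` (A - {a})) = card B" using card_mono[OF finB sub] by linarith
qed

lemma other_nb:
  assumes "b \<in> B" obtains a' where "(a', b) \<in> E" "a' \<noteq> a"
  using nb_remove1[of a] assms by blast

lemma deg_ge_2:
  assumes "a \<in> A" shows "2 \<le> card (E `` {a})"
  using surplus[of "{a}"] assms two_le by (cases "A = {a}") auto

end

section \<open>Uncrossing tight sets\<close>

text \<open>\<open>ex_tight\<close> is minimality in terms of neighbourhoods: without the arc
  \<open>(a, b)\<close> the set \<open>X\<close> loses its neighbour \<open>b\<close> and keeps at
  most \<open>card X\<close> neighbours. By \<open>surplus\<close> the bound
  \<open>card X + 1\<close> is attained.\<close>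

locale minimal_surplus = surplus +
  assumes ex_tight: "\<And>a b. (a, b) \<in> E \<Longrightarrow> \<exists>X. X \<subset> A \<and> a \<in> X \<and> card (E `` X) \<le> card X + 1 \<and>
    (\<forall>a'\<in>X. (a', b) \<in> E \<longrightarrow> a' = a)"
begin

definition tight :: "'a \<Rightarrow> 'a \<Rightarrow> 'a set \<Rightarrow> bool" where
  "tight a b X \<longleftrightarrow> (a, b) \<in> E \<and> X \<subset> A \<and> a \<in> X \<and> card (E `` X) \<le> card X + 1 \<and>
    (\<forall>a'\<in>X. (a', b) \<in> E \<longrightarrow> a' = a)"

text \<open>Let \<open>L\<close> be tight for \<open>(a, b')\<close>; it misses \<open>a'\<close>.
  If \<open>X\<close> missed \<open>a'\<close> too, the union of \<open>X\<close> and
  \<open>L\<close> would be proper, so by submodularity their intersection \<open>Z\<close> would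
  have surplus at most one. In \<open>Z\<close> both \<open>b\<close> and \<open>b'\<close> have
  \<open>a\<close> as only neighbour, so dropping \<open>a\<close> costs two neighbours and leaves
  no surplus. The degree of \<open>a\<close> rules out that nothing else is left.\<close>

lemma tight_step_mem:
  assumes X: "tight a b X" and deg: "3 \<le> card (E `` {a})"
    and b': "(a, b') \<in> E" "b' \<noteq> b" and a': "(a', b') \<in> E" "a' \<noteq> a"
  shows "a' \<in> X"
proof (rule ccontr)
  assume "a' \<notin> X"
  obtain L where L: "tight a b' L" using ex_tight[OF b'(1)] b'(1) by (auto simp: tight_def)
  have "a' \<notin> L" using L a' by (auto simp: tight_def)
  have "a' \<in> A" using a'(1) E_sub by blast
  have U: "card (X \<union> L) < card (E `` (X \<union> L))"
    using X L \<open>a' \<notin> X\<close> \<open>a' \<notin> L\<close> \<open>a' \<in> A\<close> by (intro surplus) (auto simp: tight_def)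
  define Z where "Z = X \<inter> L"
  have fin: "finite X" "finite L" "finite Z"
    using X L finite_subset[OF _ finA] by (auto simp: tight_def Z_def)
  have "card (E `` Z) + card (E `` (X \<union> L)) \<le> card X + 1 + (card L + 1)"
    using nb_submod[of X L] X L unfolding tight_def Z_def by linarith
  then have Z: "card (E `` Z) \<le> card Z + 1"
    using U card_Un_Int[OF fin(1,2)] unfolding Z_def by linarith
  have aZ: "a \<in> Z" using X L by (auto simp: tight_def Z_def)
  then have cZ: "card Z = Suc (card (Z - {a}))" using fin by (metis card_Suc_Diff1)
  have "Z - {a} \<noteq> {}"
  proof
    assume "Z - {a} = {}"
    then have "Z = {a}" using aZ by blast
    then show False using Z deg by simp
  qed
  then have lt: "card (Z - {a}) < card (E `` (Z - {a}))"
    using X aZ by (intro surplus) (auto simp: tight_def Z_def)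
  have "b \<in> E `` Z" "b' \<in> E `` Z" using X b' aZ by (auto simp: tight_def)
  then have "card (E `` Z - {b, b'}) = card (E `` Z) - 2"
    using b'(2) finite_nb by (subst card_Diff_subset) auto
  moreover have "E `` (Z - {a}) \<subseteq> E `` Z - {b, b'}"
    using X L by (auto simp: tight_def Z_def)
  then have "card (E `` (Z - {a})) \<le> card (E `` Z - {b, b'})"
    using finite_nb by (intro card_mono) auto
  ultimately show False using lt Z cZ by linarith
qed

text \<open>Tight sets shrink along a walk as long as the vertices of \<open>A\<close> passed have degree at least three;
  this is what prevents the walk from coming back.\<close>
lemma tight_step:
  assumes X: "tight a b X" and deg: "3 \<le> card (E `` {a})"
    and b': "(a, b') \<in> E" "b' \<noteq> b" and a': "(a', b') \<in> E" "a' \<noteq> a"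
  obtains X' where "tight a' b' X'" "X' \<subseteq> X"
proof -
  obtain R where R: "tight a' b' R" using ex_tight[OF a'(1)] a'(1) by (auto simp: tight_def)
  have a'X: "a' \<in> X" by (rule tight_step_mem[OF X deg b' a'])
  have aR: "a \<notin> R" using R b' a' by (auto simp: tight_def)
  have fin: "finite X" "finite R" using X R finite_subset[OF _ finA] by (auto simp: tight_def)
  have bounds: "card (E `` X) \<le> card X + 1" "card (E `` R) \<le> card R + 1"
    using X R by (auto simp: tight_def)
  have "card (E `` (R \<inter> X)) \<le> card (R \<inter> X) + 1"
  proof (cases "R \<union> X = A")
    case False
    then have "card (R \<union> X) < card (E `` (R \<union> X))"
      using R X by (intro surplus) (auto simp: tight_def)
    then show ?thesis
      using nb_submod[of R X] bounds card_Un_Int[OF fin(2,1)] by linarith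
  next
    \<comment> \<open>The union now has surplus zero instead of one. The vertex \<open>b\<close>
      compensates: it is a neighbour of \<open>X\<close> through \<open>a\<close> and of
      \<open>R\<close> through \<open>c\<close>, but not of the intersection, because
      \<open>a\<close> is not in \<open>R\<close>.\<close>
    case True
    have ab: "(a, b) \<in> E" using X by (simp add: tight_def)
    then obtain c where c: "(c, b) \<in> E" "c \<noteq> a" using other_nb E_sub by blast
    have "c \<notin> X" using c X by (auto simp: tight_def)
    moreover have "c \<in> A" using c E_sub by blast
    ultimately have "c \<in> R" using True by blast
    have "b \<in> E `` R" using \<open>c \<in> R\<close> c by blast
    moreover have "b \<in> E `` X" using X by (auto simp: tight_def)
    moreover have "b \<notin> E `` (R \<inter> X)" using X aR by (auto simp: tight_def)
    ultimately have "card (E `` (R \<inter> X)) + card (E `` (R \<union> X)) < card (E `` R) + card (E `` X)"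
      by (rule nb_submod_strict)
    moreover have "E `` A = B" using nb_remove1[of a] E_sub by blast
    ultimately show ?thesis
      using True bounds card_Un_Int[OF fin(2,1)] card_eq by simp
  qed
  then have "tight a' b' (R \<inter> X)" using R X a'X by (auto simp: tight_def)
  then show ?thesis using that by blast
qed

section \<open>Walks through vertices of large degree\<close>

definition A3 :: "'a set" where "A3 = {a \<in> A. 3 \<le> card (E `` {a})}"

text \<open>\<open>walk a0 b0 a b\<close>: a non-backtracking walk from \<open>b0\<close> through \<open>A3 - {a0}\<close> arrives at \<open>a\<close> via \<open>b\<close>.\<close>
inductive walk :: "'a \<Rightarrow> 'a \<Rightarrow> 'a \<Rightarrow> 'a \<Rightarrow> bool" for a0 b0 where
  start: "(a, b0) \<in> E \<Longrightarrow> a \<in> A3 \<Longrightarrow> a \<noteq> a0 \<Longrightarrow> walk a0 b0 a b0"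
| step: "walk a0 b0 a b \<Longrightarrow> (a, b') \<in> E \<Longrightarrow> b' \<noteq> b \<Longrightarrow> (a', b') \<in> E \<Longrightarrow> a' \<noteq> a \<Longrightarrow>
    a' \<in> A3 \<Longrightarrow> a' \<noteq> a0 \<Longrightarrow> walk a0 b0 a' b'"

lemma walk_mem: "walk a0 b0 a b \<Longrightarrow> a \<in> A3 \<and> a \<noteq> a0"
  by (induction rule: walk.induct) auto

text \<open>The invariant that forbids a return to \<open>a0\<close>. The first tight set misses
  \<open>a0\<close>, since its only neighbour of \<open>b0\<close> is \<open>a\<close>, and later
  ones are contained in it. If \<open>a0\<close> were adjacent to a later \<open>b'\<close>, then
  \<open>tight_step_mem\<close> would put \<open>a0\<close> into the current tight set.\<close>

lemma walk_tight:
  assumes "walk a0 b0 a b" "(a0, b0) \<in> E"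
  shows "(\<exists>X. tight a b X \<and> a0 \<notin> X) \<and> (b \<noteq> b0 \<longrightarrow> (a0, b) \<notin> E)"
  using assms(1)
proof induction
  case (start a)
  obtain X where "tight a b0 X" using ex_tight[OF start(1)] start(1) by (auto simp: tight_def)
  moreover from this have "a0 \<notin> X" using assms(2) start(3) by (auto simp: tight_def)
  ultimately show ?case by blast
next
  case (step a b b' a')
  obtain X where X: "tight a b X" "a0 \<notin> X" using step.IH by blast
  have deg: "3 \<le> card (E `` {a})" and "a0 \<noteq> a"
    using walk_mem[OF step.hyps(1)] by (auto simp: A3_def)
  obtain X' where "tight a' b' X'" "X' \<subseteq> X"
    using tight_step[OF X(1) deg step.hyps(2-5)] .
  moreover have "(a0, b') \<notin> E"
    using tight_step_mem[OF X(1) deg step.hyps(2,3) _ \<open>a0 \<noteq> a\<close>] X(2) by blast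
  ultimately show ?case using X(2) by blast
qed

text \<open>The vertices of \<open>S\<close> serve as hyperedges on \<open>B\<close>. The components
  of this hypergraph are the classes of the reflexive transitive closure of
  \<open>link S\<close>.\<close>

definition link :: "'a set \<Rightarrow> ('a \<times> 'a) set" where
  "link S = {(b, b'). \<exists>a\<in>S. (a, b) \<in> E \<and> (a, b') \<in> E}"

lemma link_walk:
  assumes "(b0, b) \<in> (link (A3 - {a0}))\<^sup>*"
  shows "b = b0 \<or> (\<exists>a c. walk a0 b0 a c \<and> (a, b) \<in> E)"
  using assms
proof (induction rule: rtrancl_induct)
  case base
  then show ?case by simp
next
  case (step b b')
  obtain a where a: "a \<in> A3" "a \<noteq> a0" "(a, b) \<in> E" "(a, b') \<in> E"
    using step.hyps(2) by (auto simp: link_def)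
  show ?case
  proof (cases "b = b0")
    case True
    then show ?thesis using walk.start[of a b0 a0] a by blast
  next
    case False
    obtain a1 c where w: "walk a0 b0 a1 c" "(a1, b) \<in> E" using step.IH False by blast
    show ?thesis
    proof (cases "c = b")
      case False
      then show ?thesis using walk.step[OF w(1,2) _ a(3) _ a(1,2)] w a by blast
    next
      \<comment> \<open>Leaving \<open>a1\<close> through the vertex \<open>b\<close> by which it
        was entered would be backtracking. Instead \<open>a1\<close> is skipped: its predecessor
        \<open>a2\<close> is also adjacent to \<open>b\<close>, so the walk goes from
        \<open>a2\<close> to \<open>a\<close>, or ends at \<open>a2\<close> if the two
        coincide.\<close>
      case True
      then have "walk a0 b0 a1 b" using w by simp
      then show ?thesis
      proof cases
        case start
        then show ?thesis using \<open>b \<noteq> b0\<close> by simp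
      next
        case (step a2 c2)
        then show ?thesis using walk.step[OF step(1,2,3) a(3) _ a(1,2)] a by blast
      qed
    qed
  qed
qed

text \<open>Otherwise a walk from \<open>b0\<close> reaches a vertex \<open>a\<close> adjacent to
  \<open>b\<close>. One more use of \<open>tight_step_mem\<close>, with \<open>a0\<close> as next
  vertex, puts \<open>a0\<close> into a tight set that misses it. The vertex \<open>a0\<close> may
  have degree two, which \<open>card_deg2_ge\<close> exploits.\<close>

lemma nb_separated:
  assumes "(a0, b0) \<in> E" "(a0, b) \<in> E" "S \<subseteq> A3 - {a0}" "(b0, b) \<in> (link S)\<^sup>*"
  shows "b = b0"
proof (rule ccontr)
  assume ne: "b \<noteq> b0"
  have "link S \<subseteq> link (A3 - {a0})" using assms(3) by (auto simp: link_def)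
  then have "(b0, b) \<in> (link (A3 - {a0}))\<^sup>*" using assms(4) rtrancl_mono by blast
  then obtain a c where w: "walk a0 b0 a c" "(a, b) \<in> E" using link_walk ne by blast
  obtain X where X: "tight a c X" "a0 \<notin> X" and c: "c \<noteq> b0 \<longrightarrow> (a0, c) \<notin> E"
    using walk_tight[OF w(1) assms(1)] by blast
  have deg: "3 \<le> card (E `` {a})" and "a0 \<noteq> a"
    using walk_mem[OF w(1)] by (auto simp: A3_def)
  have "b \<noteq> c" using c ne assms(2) by blast
  then show False
    using tight_step_mem[OF X(1) deg w(2) _ assms(2) \<open>a0 \<noteq> a\<close>] X(2) by blast
qed

section \<open>Counting components\<close>

definition comps :: "'a set \<Rightarrow> 'a set set" where
  "comps S = (\<lambda>b. (link S)\<^sup>* `` {b}) ` B"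

lemma link_eq:
  assumes "(b, b') \<in> (link S)\<^sup>*"
  shows "(link S)\<^sup>* `` {b} = (link S)\<^sup>* `` {b'}"
proof -
  have "sym (link S)" by (auto simp: sym_def link_def)
  then have "(b', b) \<in> (link S)\<^sup>*" using assms by (meson sym_rtrancl symD)
  then show ?thesis using assms by (auto intro: rtrancl_trans)
qed

lemma card_nb_comps:
  assumes "a \<in> A" "S \<subseteq> A3 - {a}"
  shows "card ((\<lambda>b. (link S)\<^sup>* `` {b}) ` (E `` {a})) = card (E `` {a})"
proof (rule card_image, rule inj_onI)
  fix b c assume "b \<in> E `` {a}" "c \<in> E `` {a}" "(link S)\<^sup>* `` {b} = (link S)\<^sup>* `` {c}"
  then show "b = c" using nb_separated[of a c b S] assms(2) by blast
qed

text \<open>The neighbours of \<open>a\<close> lie in different components by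
  \<open>card_nb_comps\<close>. The new hyperedge merges these into one, so the number of components
  drops by the degree of \<open>a\<close> minus one.\<close>

lemma card_comps_insert:
  assumes a: "a \<in> A3" "S \<subseteq> A3 - {a}"
  shows "card (comps (insert a S)) + (card (E `` {a}) - 1) \<le> card (comps S)"
proof -
  define cl where "cl b = (link S)\<^sup>* `` {b}" for b
  define cl' where "cl' b = (link (insert a S))\<^sup>* `` {b}" for b
  have aA: "a \<in> A" using a by (simp add: A3_def)
  obtain b0 where b0: "(a, b0) \<in> E"
    using deg_ge_2[OF aA] by (cases "E `` {a} = {}") auto
  have comps: "comps S = cl ` B" "comps (insert a S) = cl' ` B"
    by (simp_all add: comps_def cl_def cl'_def)
  define K where "K = cl ` (E `` {a})"
  have K: "card K = card (E `` {a})"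
    unfolding K_def cl_def using card_nb_comps[OF aA a(2)] .
  have KB: "K \<subseteq> cl ` B" unfolding K_def using E_sub by blast
  have same: "cl' b = cl' c" if "(a, b) \<in> E" "(a, c) \<in> E" for b c
    unfolding cl'_def using that by (intro link_eq r_into_rtrancl) (auto simp: link_def)
  have mono: "(link S)\<^sup>* \<subseteq> (link (insert a S))\<^sup>*"
    by (intro rtrancl_mono) (auto simp: link_def)
  \<comment> \<open>\<open>g\<close> sends an old component to the new component containing it. It
    maps onto the new components and is constant on \<open>K\<close>.\<close>
  define g where "g k = (link (insert a S))\<^sup>* `` k" for k
  have g: "g (cl b) = cl' b" for b
    unfolding g_def cl_def cl'_def using mono by (auto intro: rtrancl_trans)
  have "cl' ` B \<subseteq> insert (cl' b0) (g ` (cl ` B - K))"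
  proof
    fix k assume "k \<in> cl' ` B"
    then obtain b where b: "b \<in> B" "k = g (cl b)" using g by auto
    show "k \<in> insert (cl' b0) (g ` (cl ` B - K))"
    proof (cases "cl b \<in> K")
      case True
      then obtain c where "(a, c) \<in> E" "cl b = cl c" by (auto simp: K_def)
      then show ?thesis using b g same[OF b0] by simp
    qed (use b in blast)
  qed
  then have "card (cl' ` B) \<le> card (insert (cl' b0) (g ` (cl ` B - K)))"
    using finB by (intro card_mono) auto
  also have "\<dots> \<le> Suc (card (g ` (cl ` B - K)))" by (rule card_insert_le_m1) simp_all
  also have "\<dots> \<le> Suc (card (cl ` B - K))" using finB by (simp add: card_image_le)
  also have "card (cl ` B - K) = card (cl ` B) - card K"
    using KB finB finite_subset by (intro card_Diff_subset) blast+
  finally have "card (cl' ` B) \<le> Suc (card (cl ` B) - card K)" .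
  moreover have "card K \<le> card (cl ` B)" using KB finB by (intro card_mono) auto
  moreover have "2 \<le> card K" using K deg_ge_2[OF aA] by simp
  ultimately show ?thesis using K comps by simp
qed

lemma card_comps_bound:
  assumes "S \<subseteq> A3"
  shows "card (comps S) + (\<Sum>a\<in>S. card (E `` {a}) - 1) \<le> card B"
proof -
  have "finite A3" using finA by (simp add: A3_def)
  then have "finite S" using assms finite_subset by blast
  then show ?thesis using assms
  proof (induction S rule: finite_induct)
    case empty
    then show ?case using card_image_le[OF finB] by (simp add: comps_def)
  next
    case (insert a S)
    then show ?case using card_comps_insert[of a S] by fastforce
  qed
qed

text \<open>Inserting all of \<open>A3\<close> starts from at most \<open>card B\<close> components
  and must leave at least two. Expressing the degree sum over \<open>A3\<close> by
  \<open>card E\<close> and the number of vertices of degree two turns this into the bound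
  \<open>m - n + 2\<close>, where \<open>n = 2 * card A\<close>; it is written without
  subtraction.\<close>

lemma card_deg2_ge:
  "card E + 2 \<le> card {a \<in> A. card (E `` {a}) = 2} + 2 * card A"
proof -
  define A2 where "A2 = {a \<in> A. card (E `` {a}) = 2}"
  have A: "A = A2 \<union> A3" "A2 \<inter> A3 = {}" using deg_ge_2 by (force simp: A2_def A3_def)+
  have fin: "finite A2" "finite A3" using finA by (simp_all add: A2_def A3_def)
  have cA: "card A = card A2 + card A3" using A fin card_Un_disjoint by metis
  have "(\<Sum>a\<in>A3. card (E `` {a})) = (\<Sum>a\<in>A3. (card (E `` {a}) - 1) + 1)"
    by (intro sum.cong) (auto simp: A3_def)
  then have s: "(\<Sum>a\<in>A3. card (E `` {a})) = (\<Sum>a\<in>A3. card (E `` {a}) - 1) + card A3"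
    by (simp only: sum.distrib) simp
  have bound: "card (comps A3) + (\<Sum>a\<in>A3. card (E `` {a}) - 1) \<le> card A2 + card A3"
    using card_comps_bound[of A3] card_eq cA by simp
  \<comment> \<open>If all degrees were at least three, the sum would be at least
    \<open>2 * card A\<close>, which exceeds \<open>card B\<close>.\<close>
  have "card A2 \<noteq> 0"
  proof
    assume "card A2 = 0"
    moreover have "(\<Sum>a\<in>A3. card (E `` {a}) - 1) \<ge> (\<Sum>a\<in>A3. 2)"
      by (intro sum_mono) (auto simp: A3_def)
    ultimately show False using bound two_le cA by simp
  qed
  then obtain a where a: "a \<in> A2" by fastforce
  \<comment> \<open>The two neighbours of a vertex of degree two are in different components, which
    accounts for the summand 2.\<close>
  have "card ((\<lambda>b. (link A3)\<^sup>* `` {b}) ` (E `` {a})) = 2"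
    using a card_nb_comps[of a A3] by (auto simp: A2_def A3_def)
  moreover have "(\<lambda>b. (link A3)\<^sup>* `` {b}) ` (E `` {a}) \<subseteq> comps A3"
    using E_sub by (auto simp: comps_def)
  ultimately have "2 \<le> card (comps A3)"
    using finB by (metis card_mono comps_def finite_imageI)
  moreover have "E = (SIGMA a:A. E `` {a})" using E_sub by auto
  then have "card E = (\<Sum>a\<in>A. card (E `` {a}))"
    using finA finite_nb by (metis card_SigmaI)
  then have "card E = (\<Sum>a\<in>A2. card (E `` {a})) + (\<Sum>a\<in>A3. card (E `` {a}))"
    using A fin by (metis sum.union_disjoint)
  moreover have "(\<Sum>a\<in>A2. card (E `` {a})) = 2 * card A2" by (simp add: A2_def)
  ultimately show ?thesis using bound s cA unfolding A2_def by linarith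
qed

end

section \<open>From multigraphs to relations and back\<close>

definition bipartition :: "('v, 'e) mgraph \<Rightarrow> 'v set \<Rightarrow> 'v set \<Rightarrow> bool" where
  "bipartition G A B \<longleftrightarrow> A \<union> B = verts G \<and> A \<inter> B = {} \<and>
     (\<forall>e\<in>edges G. \<exists>a\<in>A. \<exists>b\<in>B. ends G e = {a, b})"

text \<open>Edge identities are forgotten, so parallel edges collapse to one arc.\<close>

definition arcs :: "('v, 'e) mgraph \<Rightarrow> 'v set \<Rightarrow> 'v set \<Rightarrow> ('v \<times> 'v) set" where
  "arcs G A B = {(a, b). a \<in> A \<and> b \<in> B \<and> (\<exists>e\<in>edges G. ends G e = {a, b})}"

lemma bipartition_swap: "bipartition G A B \<Longrightarrow> bipartition G B A"
  unfolding bipartition_def by (metis Int_commute Un_commute insert_commute)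

lemma bipartition_imp_bipartite: "bipartition G A B \<Longrightarrow> bipartite G"
  unfolding bipartition_def bipartite_def by (intro exI)

lemma bipartition_delete: "bipartition G A B \<Longrightarrow> bipartition (delete_edge G e) A B"
  by (auto simp: bipartition_def delete_edge_def)

lemma bipartition_edgeE:
  assumes "bipartition G A B" "e \<in> edges G"
  obtains a b where "a \<in> A" "b \<in> B" "ends G e = {a, b}" "(a, b) \<in> arcs G A B"
  using assms unfolding bipartition_def arcs_def by blast

lemma bipartition_ends_eq:
  assumes "bipartition G A B" "a \<in> A" "b \<in> B" "a' \<in> A" "b' \<in> B" "{a, b} = {a', b'}"
  shows "a = a' \<and> b = b'"
  using assms unfolding bipartition_def doubleton_eq_iff by blast

lemma bipartition_finite:
  assumes "multigraph G" "bipartition G A B"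
  shows "finite A" "finite B" "card (verts G) = card A + card B"
proof -
  show "finite A" "finite B"
    using assms finite_Un[of A B] by (simp_all add: multigraph_def bipartition_def)
  then show "card (verts G) = card A + card B"
    using assms(2) card_Un_disjoint[of A B] by (simp add: bipartition_def)
qed

text \<open>The last clause ties \<open>f\<close> to the edges of \<open>M\<close>: an edge
  prescribed to lie in \<open>M\<close> fixes a value of \<open>f\<close>.\<close>

lemma perfect_matching_bij:
  assumes bip: "bipartition G A B" and M: "perfect_matching G M"
  obtains f where "bij_betw f A B" "\<And>a. a \<in> A \<Longrightarrow> (a, f a) \<in> arcs G A B"
    "\<And>e a b. e \<in> M \<Longrightarrow> a \<in> A \<Longrightarrow> b \<in> B \<Longrightarrow> ends G e = {a, b} \<Longrightarrow> f a = b"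
proof -
  have ex: "\<exists>b e. e \<in> M \<and> b \<in> B \<and> ends G e = {a, b}" if a: "a \<in> A" for a
  proof -
    obtain e where e: "e \<in> M" "a \<in> ends G e"
      using M bip a unfolding perfect_matching_def bipartition_def by blast
    then have "e \<in> edges G" using M by (auto simp: perfect_matching_def)
    then obtain a' b where ab: "a' \<in> A" "b \<in> B" "ends G e = {a', b}"
      by (rule bipartition_edgeE[OF bip])
    then have "a' = a" using e a bip by (auto simp: bipartition_def)
    then show ?thesis using e ab by blast
  qed
  then obtain f ed where f: "\<And>a. a \<in> A \<Longrightarrow> ed a \<in> M \<and> f a \<in> B \<and> ends G (ed a) = {a, f a}"
    by metis
  have same: "e = e'" if "e \<in> M" "e' \<in> M" "v \<in> A \<union> B" "v \<in> ends G e" "v \<in> ends G e'" for v e e'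
    using M bip that unfolding perfect_matching_def bipartition_def by blast
  have val: "f a = b" if "e \<in> M" "a \<in> A" "b \<in> B" "ends G e = {a, b}" for e a b
  proof -
    have "e = ed a" using same[of e "ed a" a] f[of a] that by simp
    then show ?thesis using f[of a] that bip by (auto simp: doubleton_eq_iff)
  qed
  have "inj_on f A"
  proof (rule inj_onI)
    fix a a' assume a: "a \<in> A" "a' \<in> A" "f a = f a'"
    have "ed a = ed a'" using same[of "ed a" "ed a'" "f a"] f[of a] f[of a'] a by simp
    then show "a = a'"
      using f[of a] f[of a'] a by (metis doubleton_eq_iff)
  qed
  moreover have "B \<subseteq> f ` A"
  proof
    fix b assume b: "b \<in> B"
    obtain e where e: "e \<in> M" "b \<in> ends G e"
      using M bip b unfolding perfect_matching_def bipartition_def by blast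
    then have "e \<in> edges G" using M by (auto simp: perfect_matching_def)
    then obtain a b' where ab: "a \<in> A" "b' \<in> B" "ends G e = {a, b'}"
      by (rule bipartition_edgeE[OF bip])
    then have "b' = b" using e b bip by (auto simp: bipartition_def)
    then show "b \<in> f ` A" using val[OF e(1) ab(1) b] ab by blast
  qed
  ultimately have "bij_betw f A B" using f by (auto simp: bij_betw_def)
  moreover have "(a, f a) \<in> arcs G A B" if "a \<in> A" for a
    using f[OF that] M that by (auto simp: arcs_def perfect_matching_def)
  ultimately show thesis using that val by blast
qed

lemma connected_leaves:
  assumes "connected_graph G" "K \<subset> verts G" "K \<noteq> {}"
  obtains u v where "u \<in> K" "v \<notin> K" "(u, v) \<in> adj G"
proof -
  obtain u w where uw: "u \<in> K" "w \<in> verts G" "w \<notin> K" using assms(2,3) by blast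
  have "(u, w) \<in> (adj G)\<^sup>*" using assms(1,2) uw unfolding connected_graph_def by blast
  then have "w \<in> K" if "\<And>x y. x \<in> K \<Longrightarrow> (x, y) \<in> adj G \<Longrightarrow> y \<in> K"
    by (induction rule: rtrancl_induct) (use uw that in auto)
  then show thesis using uw that by blast
qed

text \<open>No edge joins \<open>X\<close> to a vertex outside its neighbourhood. An edge leaving
  \<open>K\<close>, which exists by connectivity, therefore joins a vertex outside \<open>X\<close>
  to a neighbour \<open>b\<close> of \<open>X\<close>. A perfect matching containing it maps
  \<open>X\<close> into the neighbourhood of \<open>X\<close> without \<open>b\<close>.\<close>

lemma matching_covered_surplus:
  assumes mc: "matching_covered G" and bip: "bipartition G A B"
  shows "surplus A B (arcs G A B)"
proof -
  let ?E = "arcs G A B"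
  have mg: "multigraph G" and con: "connected_graph G" and four: "4 \<le> card (verts G)"
    and cov: "\<And>e. e \<in> edges G \<Longrightarrow> \<exists>M. perfect_matching G M \<and> e \<in> M"
    using mc by (auto simp: matching_covered_def)
  note fin = bipartition_finite[OF mg bip]
  have sub: "?E \<subseteq> A \<times> B" by (auto simp: arcs_def)
  obtain v where v: "v \<in> verts G" using con by (auto simp: connected_graph_def)
  \<comment> \<open>Equal sides need some perfect matching, hence first some edge; connectivity
    supplies one because there is more than one vertex.\<close>
  have "card {v} \<noteq> card (verts G)" using four by simp
  then have "{v} \<noteq> verts G" by metis
  then obtain u w where "(u, w) \<in> adj G"
    using connected_leaves[OF con, of "{v}"] v by blast
  then obtain e0 where "e0 \<in> edges G" by (auto simp: adj_def)
  then obtain M0 where "perfect_matching G M0" using cov by blast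
  then obtain f0 where "bij_betw f0 A B" by (rule perfect_matching_bij[OF bip])
  then have card: "card A = card B" by (rule bij_betw_same_card)
  show ?thesis
  proof
    show "finite A" "finite B" "?E \<subseteq> A \<times> B" "card A = card B" by fact+
    show "2 \<le> card A" using four fin card by simp
  next
    fix X assume X: "X \<subseteq> A" "X \<noteq> {}" "X \<noteq> A"
    have finX: "finite X" using X fin finite_subset by blast
    have finN: "finite (?E `` X)" using sub fin by (intro finite_subset[OF _ fin(2)]) blast
    define K where "K = (A - X) \<union> (B - ?E `` X)"
    have "K \<subset> verts G" "K \<noteq> {}"
      using X bip unfolding K_def bipartition_def by blast+
    then obtain u w where uw: "u \<in> K" "w \<notin> K" "(u, w) \<in> adj G"
      using connected_leaves[OF con] by blast
    then obtain e where e: "e \<in> edges G" "ends G e = {u, w}" by (auto simp: adj_def)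
    obtain a b where ab: "a \<in> A" "b \<in> B" "ends G e = {a, b}" "(a, b) \<in> ?E"
      by (rule bipartition_edgeE[OF bip e(1)])
    have "u = a \<and> w = b \<or> u = b \<and> w = a" using ab e by (auto simp: doubleton_eq_iff)
    then have abX: "a \<notin> X" "b \<in> ?E `` X"
      using uw ab X bip by (auto simp: K_def bipartition_def)
    obtain M where M: "perfect_matching G M" "e \<in> M" using cov e by blast
    obtain f where f: "bij_betw f A B" "\<And>a. a \<in> A \<Longrightarrow> (a, f a) \<in> ?E"
      "\<And>e a b. e \<in> M \<Longrightarrow> a \<in> A \<Longrightarrow> b \<in> B \<Longrightarrow> ends G e = {a, b} \<Longrightarrow> f a = b"
      using perfect_matching_bij[OF bip M(1)] by metis
    have fa: "f a = b" using f(3)[OF M(2)] ab by blast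
    have "b \<notin> f ` X"
      using f(1) X(1) abX(1) ab(1) unfolding fa[symmetric] bij_betw_def by (auto dest: inj_onD)
    moreover have "f ` X \<subseteq> ?E `` X" using f(2) X(1) by blast
    ultimately have "card (f ` X) < card (?E `` X)"
      using abX(2) finN by (intro psubset_card_mono) auto
    moreover have "card (f ` X) = card X"
      using f(1) X(1) by (meson bij_betw_def card_image inj_on_subset)
    ultimately show "card X < card (?E `` X)" by simp
  qed
qed

text \<open>If a component \<open>K\<close> contained only part of \<open>A\<close>, the parts of
  \<open>A\<close> inside and outside \<open>K\<close> would have disjoint neighbourhoods, each
  larger than its part, and \<open>B\<close> would be larger than \<open>A\<close>.\<close>

lemma surplus_connected:
  assumes mg: "multigraph G" and bip: "bipartition G A B" and s: "surplus A B (arcs G A B)"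
  shows "connected_graph G"
proof -
  let ?E = "arcs G A B"
  interpret surplus A B ?E by (rule s)
  have EA: "?E `` A = B" using nb_remove1 E_sub by blast
  have sym: "sym (adj G)" by (auto simp: sym_def adj_def insert_commute)
  have adjI: "(a, b) \<in> adj G" "(b, a) \<in> adj G" if "(a, b) \<in> ?E" for a b
    using that by (auto simp: arcs_def adj_def insert_commute)
  have all: "verts G \<subseteq> (adj G)\<^sup>* `` {u}" if u: "u \<in> A" for u
  proof -
    define K where "K = (adj G)\<^sup>* `` {u}"
    have step: "y \<in> K" if "x \<in> K" "(x, y) \<in> adj G" for x y
      using that by (auto simp: K_def intro: rtrancl_into_rtrancl)
    have "u \<in> K" by (simp add: K_def)
    have AK: "A \<subseteq> K"
    proof (rule ccontr)
      assume "\<not> A \<subseteq> K"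
      let ?X = "A \<inter> K" and ?Y = "A - K"
      have X: "card ?X < card (?E `` ?X)" and Y: "card ?Y < card (?E `` ?Y)"
        using \<open>\<not> A \<subseteq> K\<close> \<open>u \<in> K\<close> u by (intro surplus; blast)+
      have "?E `` ?X \<subseteq> K" "?E `` ?Y \<inter> K = {}" using step adjI by blast+
      then have "?E `` ?X \<inter> ?E `` ?Y = {}" by blast
      then have "card (?E `` ?X) + card (?E `` ?Y) = card (?E `` ?X \<union> ?E `` ?Y)"
        using finite_nb by (simp add: card_Un_disjoint)
      also have "\<dots> \<le> card B" using E_sub finB by (intro card_mono) auto
      also have "card B = card ?X + card ?Y"
        using finA card_eq by (metis card_Int_Diff)
      finally show False using X Y by linarith
    qed
    then have "B \<subseteq> K" using EA step adjI by blast
    then show ?thesis using AK bip by (auto simp: K_def bipartition_def)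
  qed
  obtain u where u: "u \<in> A" using two_le by (cases "A = {}") auto
  have "(v, w) \<in> (adj G)\<^sup>*" if "v \<in> verts G" "w \<in> verts G" for v w
  proof -
    have "(u, v) \<in> (adj G)\<^sup>*" "(u, w) \<in> (adj G)\<^sup>*" using all[OF u] that by blast+
    moreover from this have "(v, u) \<in> (adj G)\<^sup>*" using sym by (meson sym_rtrancl symD)
    ultimately show ?thesis by (rule_tac rtrancl_trans)
  qed
  moreover have "verts G \<noteq> {}" using u bip by (auto simp: bipartition_def)
  ultimately show ?thesis by (simp add: connected_graph_def)
qed

text \<open>Once both ends of \<open>e0\<close> are removed, a set of remaining vertices loses at
  most the neighbour \<open>b0\<close>, so its surplus still gives Hall's condition.\<close>

lemma surplus_matching:
  assumes bip: "bipartition G A B" and s: "surplus A B (arcs G A B)" and e0: "e0 \<in> edges G"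
  shows "\<exists>M. perfect_matching G M \<and> e0 \<in> M"
proof -
  let ?E = "arcs G A B"
  interpret surplus A B ?E by (rule s)
  obtain a0 b0 where ab0: "a0 \<in> A" "b0 \<in> B" "ends G e0 = {a0, b0}"
    by (rule bipartition_edgeE[OF bip e0])
  have "\<exists>R. inj_on R (A - {a0}) \<and> (\<forall>a\<in>A - {a0}. R a \<in> ?E `` {a} - {b0})"
  proof (rule hall_marriage)
    show "finite (A - {a0})" using finA by simp
    show "finite (?E `` {a} - {b0})" for a using finite_nb by simp
    fix J assume J: "J \<subseteq> A - {a0}"
    show "card J \<le> card (\<Union>a\<in>J. ?E `` {a} - {b0})"
    proof (cases "J = {}")
      case False
      then have "card J < card (?E `` J)" using J ab0 by (intro surplus) auto
      also have "\<dots> \<le> Suc (card (?E `` J - {b0}))"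
        using finite_nb by (metis card_Suc_Diff1 card_Diff_singleton_if le_SucI order_refl)
      also have "?E `` J - {b0} = (\<Union>a\<in>J. ?E `` {a} - {b0})" by blast
      finally show ?thesis by simp
    qed simp
  qed
  then obtain R0 where R0: "inj_on R0 (A - {a0})" "\<forall>a\<in>A - {a0}. R0 a \<in> ?E `` {a} - {b0}"
    by blast
  define R where "R = R0(a0 := b0)"
  have injR: "inj_on R A" using R0 by (auto simp: inj_on_def R_def)
  have "R ` A \<subseteq> B" using R0 ab0 E_sub by (auto simp: R_def)
  then have RA: "R ` A = B"
    using finB card_image[OF injR] card_eq by (intro card_subset_eq) auto
  \<comment> \<open>Among parallel edges between \<open>a0\<close> and \<open>b0\<close> the choice
    has to be \<open>e0\<close> itself.\<close>
  have "\<exists>e. e \<in> edges G \<and> ends G e = {a, R a} \<and> (a = a0 \<longrightarrow> e = e0)" if "a \<in> A" for a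
    using R0 that ab0 e0 by (cases "a = a0") (simp_all add: R_def arcs_def, blast)
  then obtain ed where ed: "\<And>a. a \<in> A \<Longrightarrow> ed a \<in> edges G \<and> ends G (ed a) = {a, R a}" "ed a0 = e0"
    using ab0(1) by metis
  have disj: "A \<inter> B = {}" and V: "verts G = A \<union> B" using bip by (auto simp: bipartition_def)
  have "perfect_matching G (ed ` A)"
    unfolding perfect_matching_def
  proof (intro conjI ballI)
    show "ed ` A \<subseteq> edges G" using ed by blast
    fix v assume "v \<in> verts G"
    then consider "v \<in> A" | a where "a \<in> A" "v = R a" using V RA by blast
    then show "\<exists>!e. e \<in> ed ` A \<and> v \<in> ends G e"
    proof cases
      case 1
      show ?thesis
      proof (rule ex1I[of _ "ed v"])
        show "ed v \<in> ed ` A \<and> v \<in> ends G (ed v)" using 1 ed by auto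
        fix e assume "e \<in> ed ` A \<and> v \<in> ends G e"
        then obtain a where "a \<in> A" "e = ed a" "v \<in> {a, R a}" using ed by auto
        then show "e = ed v" using 1 RA disj by blast
      qed
    next
      case 2
      show ?thesis
      proof (rule ex1I[of _ "ed a"])
        show "ed a \<in> ed ` A \<and> v \<in> ends G (ed a)" using 2 ed by auto
        fix e assume "e \<in> ed ` A \<and> v \<in> ends G e"
        then obtain a' where a': "a' \<in> A" "e = ed a'" "v \<in> {a', R a'}" using ed by auto
        then have "R a' = R a" using 2 RA disj by blast
        then show "e = ed a" using a' 2 injR by (auto dest: inj_onD)
      qed
    qed
  qed
  then show ?thesis using ed(2) ab0(1) by blast
qed

lemma matching_covered_iff_surplus:
  assumes "multigraph G" "bipartition G A B"
  shows "matching_covered G \<longleftrightarrow> surplus A B (arcs G A B)"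
proof
  assume s: "surplus A B (arcs G A B)"
  then interpret surplus A B "arcs G A B" .
  show "matching_covered G"
    unfolding matching_covered_def
    using assms surplus_connected[OF assms s] surplus_matching[OF assms(2) s]
      bipartition_finite[OF assms] two_le card_eq by simp
qed (rule matching_covered_surplus[OF _ assms(2)])

section \<open>Vertices of degree two in minimal graphs\<close>

text \<open>Deleting \<open>e\<close> destroys the surplus of some \<open>X\<close>. Only
  \<open>b\<close> can have disappeared from the neighbourhood, so \<open>e\<close> is the only edge
  from \<open>X\<close> to \<open>b\<close>. Uniqueness is stated for edges and thus excludes
  parallel ones, see \<open>minimal_simple\<close>.\<close>

lemma minimal_ex_tight:
  assumes min: "minimal_matching_covered G" and bip: "bipartition G A B"
    and e: "e \<in> edges G" "ends G e = {a, b}" "a \<in> A" "b \<in> B"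
  shows "\<exists>X. X \<subset> A \<and> a \<in> X \<and> card (arcs G A B `` X) \<le> card X + 1 \<and>
    (\<forall>e'\<in>edges G. \<forall>a'\<in>X. ends G e' = {a', b} \<longrightarrow> e' = e)"
proof -
  let ?E = "arcs G A B" and ?D = "arcs (delete_edge G e) A B"
  have mc: "matching_covered G" and nmc: "\<not> matching_covered (delete_edge G e)"
    using min e by (auto simp: minimal_matching_covered_def)
  have mg: "multigraph G" using mc by (simp add: matching_covered_def)
  interpret surplus A B ?E by (rule matching_covered_surplus[OF mc bip])
  have mg': "multigraph (delete_edge G e)" using mg by (auto simp: multigraph_def delete_edge_def)
  have "\<not> surplus A B ?D"
    using nmc matching_covered_iff_surplus[OF mg' bipartition_delete[OF bip]] by blast
  moreover have "?D \<subseteq> A \<times> B" by (auto simp: arcs_def)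
  ultimately obtain X where X: "X \<subseteq> A" "X \<noteq> {}" "X \<noteq> A" "card (?D `` X) \<le> card X"
    using finA finB card_eq two_le unfolding surplus_def by (meson not_less)
  have DE: "?D `` X \<subseteq> ?E `` X" by (auto simp: arcs_def delete_edge_def)
  have ED: "?E `` X \<subseteq> insert b (?D `` X)"
  proof
    fix y assume "y \<in> ?E `` X"
    then obtain x f where xf: "x \<in> X" "x \<in> A" "y \<in> B" "f \<in> edges G" "ends G f = {x, y}"
      by (auto simp: arcs_def)
    show "y \<in> insert b (?D `` X)"
    proof (cases "f = e")
      case True
      then show ?thesis using bipartition_ends_eq[OF bip xf(2,3) e(3,4)] xf e by auto
    next
      case False
      then show ?thesis using xf by (auto simp: arcs_def delete_edge_def)
    qed
  qed
  have finD: "finite (?D `` X)" using DE finite_nb finite_subset by blast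
  have s: "card X < card (?E `` X)" using X by (intro surplus)
  have "card (?E `` X) \<le> card (insert b (?D `` X))" using ED finD by (intro card_mono) auto
  also have "\<dots> \<le> Suc (card (?D `` X))" by (rule card_insert_le_m1) simp_all
  finally have le: "card (?E `` X) \<le> card X + 1" using X(4) by simp
  have bD: "b \<notin> ?D `` X"
  proof
    assume "b \<in> ?D `` X"
    then have "?E `` X = ?D `` X" using ED DE by blast
    then show False using X(4) s by simp
  qed
  have "?E `` X \<noteq> ?D `` X" using X(4) s by auto
  then have "b \<in> ?E `` X" using ED DE by blast
  then obtain x f where xf: "x \<in> X" "f \<in> edges G" "ends G f = {x, b}" by (auto simp: arcs_def)
  have uniq: "e' = e" if "e' \<in> edges G" "a' \<in> X" "ends G e' = {a', b}" for e' a'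
  proof (rule ccontr)
    assume "e' \<noteq> e"
    then have "(a', b) \<in> ?D" using that X(1) e(4) by (auto simp: arcs_def delete_edge_def)
    then show False using bD that by blast
  qed
  then have "f = e" using xf by blast
  then have "a \<in> X"
    using bipartition_ends_eq[OF bip e(3,4), of x b] xf e X(1) by auto
  moreover have "X \<subset> A" using X by blast
  ultimately show ?thesis
    using le by (intro exI[of _ X] conjI ballI impI) (assumption+, rule uniq)
qed

lemma minimal_simple:
  assumes "minimal_matching_covered G" "bipartition G A B"
    and "e \<in> edges G" "e' \<in> edges G" "ends G e = ends G e'"
  shows "e = e'"
proof -
  obtain a b where "a \<in> A" "b \<in> B" "ends G e = {a, b}"
    by (rule bipartition_edgeE[OF assms(2,3)])
  then show ?thesis using minimal_ex_tight[OF assms(1-3)] assms(4,5) by metis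
qed

lemma minimal_minimal_surplus:
  assumes min: "minimal_matching_covered G" and bip: "bipartition G A B"
  shows "minimal_surplus A B (arcs G A B)"
proof -
  have "matching_covered G" using min by (simp add: minimal_matching_covered_def)
  then interpret surplus A B "arcs G A B" using bip by (rule matching_covered_surplus)
  show ?thesis
  proof
    fix a b assume "(a, b) \<in> arcs G A B"
    then obtain e where e: "e \<in> edges G" "ends G e = {a, b}" "a \<in> A" "b \<in> B"
      by (auto simp: arcs_def)
    obtain X where X: "X \<subset> A" "a \<in> X" "card (arcs G A B `` X) \<le> card X + 1"
      "\<forall>e'\<in>edges G. \<forall>a'\<in>X. ends G e' = {a', b} \<longrightarrow> e' = e"
      using minimal_ex_tight[OF min bip e] by blast
    have "a' = a" if "a' \<in> X" "(a', b) \<in> arcs G A B" for a'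
    proof -
      have "ends G e = {a', b}" using that X(4) by (auto simp: arcs_def)
      then show ?thesis using bipartition_ends_eq[OF bip e(3,4), of a' b] that X(1) e by auto
    qed
    then show "\<exists>X. X \<subset> A \<and> a \<in> X \<and> card (arcs G A B `` X) \<le> card X + 1 \<and>
      (\<forall>a'\<in>X. (a', b) \<in> arcs G A B \<longrightarrow> a' = a)"
      using X by blast
  qed
qed

lemma card_nb_le_degree:
  assumes mg: "multigraph G" and bip: "bipartition G A B" and a: "a \<in> A"
  shows "card (arcs G A B `` {a}) \<le> degree G a"
proof -
  let ?I = "{e \<in> edges G. a \<in> ends G e}"
  have "\<exists>e. e \<in> ?I \<and> ends G e = {a, b}" if "b \<in> arcs G A B `` {a}" for b
    using that by (auto simp: arcs_def)
  then obtain h where h: "\<And>b. b \<in> arcs G A B `` {a} \<Longrightarrow> h b \<in> ?I \<and> ends G (h b) = {a, b}"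
    by metis
  have "inj_on h (arcs G A B `` {a})"
    by (rule inj_onI) (metis h doubleton_eq_iff)
  moreover have "h ` (arcs G A B `` {a}) \<subseteq> ?I" using h by blast
  moreover have "finite ?I" using mg by (simp add: multigraph_def)
  ultimately show ?thesis unfolding degree_def by (rule card_inj_on_le)
qed

lemma degree_le_card_nb:
  assumes mg: "multigraph G" and bip: "bipartition G A B" and a: "a \<in> A"
    and simple: "\<And>e e'. e \<in> edges G \<Longrightarrow> e' \<in> edges G \<Longrightarrow> ends G e = ends G e' \<Longrightarrow> e = e'"
  shows "degree G a \<le> card (arcs G A B `` {a})"
proof -
  let ?I = "{e \<in> edges G. a \<in> ends G e}"
  have "\<exists>b. b \<in> arcs G A B `` {a} \<and> ends G e = {a, b}" if "e \<in> ?I" for e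
  proof -
    have "e \<in> edges G" using that by simp
    then obtain a' b where ab: "a' \<in> A" "b \<in> B" "ends G e = {a', b}" "(a', b) \<in> arcs G A B"
      by (rule bipartition_edgeE[OF bip])
    then have "a' = a" using that a bip by (auto simp: bipartition_def)
    then show ?thesis using ab by blast
  qed
  then obtain h where h: "\<And>e. e \<in> ?I \<Longrightarrow> h e \<in> arcs G A B `` {a} \<and> ends G e = {a, h e}"
    by metis
  have "inj_on h ?I" using h simple by (auto simp: inj_on_def) metis
  moreover have "h ` ?I \<subseteq> arcs G A B `` {a}" using h by blast
  moreover have "finite (arcs G A B `` {a})"
    using bipartition_finite[OF mg bip] by (auto simp: arcs_def intro: finite_subset)
  ultimately show ?thesis unfolding degree_def by (rule card_inj_on_le)
qed

lemma card_arcs_simple: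
  assumes bip: "bipartition G A B"
    and simple: "\<And>e e'. e \<in> edges G \<Longrightarrow> e' \<in> edges G \<Longrightarrow> ends G e = ends G e' \<Longrightarrow> e = e'"
  shows "card (arcs G A B) = card (edges G)"
proof -
  have "\<forall>e\<in>edges G. \<exists>p. p \<in> arcs G A B \<and> ends G e = {fst p, snd p}"
    using bipartition_edgeE[OF bip] by (metis fst_conv snd_conv)
  then obtain h where h: "\<And>e. e \<in> edges G \<Longrightarrow> h e \<in> arcs G A B \<and> ends G e = {fst (h e), snd (h e)}"
    by metis
  have "inj_on h (edges G)" using h simple by (metis inj_onI)
  moreover have "h ` edges G = arcs G A B"
  proof
    show "h ` edges G \<subseteq> arcs G A B" using h by blast
    show "arcs G A B \<subseteq> h ` edges G"
    proof
      fix p assume "p \<in> arcs G A B"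
      then obtain e where e: "e \<in> edges G" "ends G e = {fst p, snd p}" "fst p \<in> A" "snd p \<in> B"
        by (auto simp: arcs_def)
      then have "h e = p"
        using h[OF e(1)] bipartition_ends_eq[OF bip e(3,4), of "fst (h e)" "snd (h e)"]
        by (auto simp: arcs_def prod_eq_iff)
      then show "p \<in> h ` edges G" using e by blast
    qed
  qed
  ultimately show ?thesis using card_image by fastforce
qed

lemma minimal_degree2_on_side:
  assumes min: "minimal_matching_covered G" and bip: "bipartition G A B"
  defines "D \<equiv> {a \<in> A. degree G a = 2}"
  shows "card (edges G) + 2 \<le> card D + 2 * card A"
    and "3 * card A \<le> card (edges G) + card D"
proof -
  let ?E = "arcs G A B"
  interpret minimal_surplus A B ?E by (rule minimal_minimal_surplus[OF min bip])
  have mg: "multigraph G"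
    using min by (simp add: minimal_matching_covered_def matching_covered_def)
  note simple = minimal_simple[OF min bip]
  have "card (?E `` {a}) = degree G a" if "a \<in> A" for a
  proof (rule antisym)
    show "card (?E `` {a}) \<le> degree G a" by (rule card_nb_le_degree[OF mg bip that])
    show "degree G a \<le> card (?E `` {a})"
      by (rule degree_le_card_nb[OF mg bip that]) (erule (2) simple)
  qed
  then have D: "D = {a \<in> A. card (?E `` {a}) = 2}" by (auto simp: D_def)
  have m: "card ?E = card (edges G)"
    by (rule card_arcs_simple[OF bip]) (erule (2) simple)
  show "card (edges G) + 2 \<le> card D + 2 * card A" using card_deg2_ge m D by simp
  have "?E = (SIGMA a:A. ?E `` {a})" using E_sub by auto
  then have "card ?E = (\<Sum>a\<in>A. card (?E `` {a}))" using finA finite_nb by (metis card_SigmaI)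
  \<comment> \<open>Every degree is at least two, and \<open>of_bool\<close> lifts exactly the
    degrees equal to two up to three.\<close>
  moreover have "(\<Sum>a\<in>A. 3) \<le> (\<Sum>a\<in>A. card (?E `` {a}) + of_bool (a \<in> D))"
  proof (rule sum_mono)
    fix a assume "a \<in> A"
    then show "3 \<le> card (?E `` {a}) + of_bool (a \<in> D)" using deg_ge_2[of a] D by auto
  qed
  moreover have "(\<Sum>a\<in>A. of_bool (a \<in> D)) = card D"
  proof -
    have "A \<inter> D = D" using D by blast
    then show ?thesis using finA by (simp add: of_bool_def sum.If_cases)
  qed
  ultimately show "3 * card A \<le> card (edges G) + card D" using m by (simp add: sum.distrib)
qed

lemma minimal_card_V2:
  assumes min: "minimal_matching_covered G" and bip: "bipartite G"
  shows "2 * card (edges G) + 4 \<le> card (V2 G) + 2 * card (verts G)"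
    and "3 * card (verts G) \<le> 2 * card (edges G) + card (V2 G)"
proof -
  obtain A B where AB: "bipartition G A B"
    using bip by (auto simp: bipartite_def bipartition_def)
  have mg: "multigraph G"
    using min by (simp add: minimal_matching_covered_def matching_covered_def)
  note fin = bipartition_finite[OF mg AB]
  have "V2 G = {a \<in> A. degree G a = 2} \<union> {b \<in> B. degree G b = 2}"
    using AB by (auto simp: V2_def bipartition_def)
  moreover have "{a \<in> A. degree G a = 2} \<inter> {b \<in> B. degree G b = 2} = {}"
    using AB by (auto simp: bipartition_def)
  ultimately have V2: "card (V2 G) = card {a \<in> A. degree G a = 2} + card {b \<in> B. degree G b = 2}"
    using fin by (simp add: card_Un_disjoint)
  note A = minimal_degree2_on_side[OF min AB] and B = minimal_degree2_on_side[OF min bipartition_swap[OF AB]]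
  show "2 * card (edges G) + 4 \<le> card (V2 G) + 2 * card (verts G)"
    and "3 * card (verts G) \<le> 2 * card (edges G) + card (V2 G)"
    using V2 A B fin(3) by linarith+
qed

text \<open>The two bounds of \<open>minimal_card_V2\<close> add up to
  \<open>2 * card (V2 G) \<ge> n + 4\<close>. The assumption is equality in this sum, which forces
  equality in the first bound.\<close>

lemma n_extremal_imp_extremal:
  assumes "minimal_matching_covered G" "bipartite G" "two_vertex_n_extremal G"
  shows "two_vertex_extremal G"
proof -
  have "2 * card (V2 G) = card (verts G) + 4"
    using assms(3) unfolding two_vertex_n_extremal_def by linarith
  then have "card (V2 G) + 2 * card (verts G) = 2 * card (edges G) + 4"
    using minimal_card_V2[OF assms(1,2)] by linarith
  then have "int (card (V2 G) + 2 * card (verts G)) = int (2 * card (edges G) + 4)" by (rule arg_cong)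
  then show ?thesis unfolding two_vertex_extremal_def by simp
qed

section \<open>A graph separating the classes\<close>

lemma matching_covered_degree:
  assumes mc: "matching_covered G" and bip: "bipartition G A B" and v: "v \<in> verts G"
  shows "2 \<le> degree G v"
proof -
  have mg: "multigraph G" using mc by (simp add: matching_covered_def)
  have side: "2 \<le> degree G v" if "bipartition G C D" "v \<in> C" for C D
    using surplus.deg_ge_2[OF matching_covered_surplus[OF mc that(1)] that(2)]
      card_nb_le_degree[OF mg that] by linarith
  show ?thesis
    using side[OF bip] side[OF bipartition_swap[OF bip]] v bip by (auto simp: bipartition_def)
qed

text \<open>Deleting an edge at a vertex of degree two leaves a vertex of degree one there, contrary
  to \<open>matching_covered_degree\<close>.\<close>

lemma minimal_if_degree2_end:
  assumes mc: "matching_covered G" and bip: "bipartite G"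
    and deg: "\<And>e. e \<in> edges G \<Longrightarrow> \<exists>v\<in>ends G e. degree G v = 2"
  shows "minimal_matching_covered G"
  unfolding minimal_matching_covered_def
proof (intro conjI ballI notI mc)
  fix e assume e: "e \<in> edges G" and mc': "matching_covered (delete_edge G e)"
  obtain A B where AB: "bipartition G A B"
    using bip by (auto simp: bipartite_def bipartition_def)
  have mg: "multigraph G" using mc by (simp add: matching_covered_def)
  obtain v where v: "v \<in> ends G e" "degree G v = 2" using deg[OF e] by blast
  have "v \<in> verts (delete_edge G e)" using mg e v by (auto simp: multigraph_def delete_edge_def)
  then have "2 \<le> degree (delete_edge G e) v"
    by (rule matching_covered_degree[OF mc' bipartition_delete[OF AB]])
  moreover have "degree (delete_edge G e) v < degree G v"
    unfolding degree_def using e v mg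
    by (intro psubset_card_mono) (auto simp: delete_edge_def multigraph_def)
  ultimately show False using v(2) by simp
qed

text \<open>Vertices 0 and 1 joined by four paths of length three.\<close>
definition theta :: "(nat, nat) mgraph" where
  "theta = \<lparr>verts = {0, 1, 2, 3, 4, 5, 6, 7, 8, 9},
    edges = {0, 1, 2, 3, 4, 5, 6, 7, 8, 9, 10, 11},
    ends = (\<lambda>e. if e < 4 then {0, e + 2} else if e < 8 then {e - 2, e + 2} else {e - 2, 1})\<rparr>"

lemma theta_edges: "edges theta = {0, 1, 2, 3, 4, 5, 6, 7, 8, 9, 10, 11}"
  and theta_verts: "verts theta = {0, 1, 2, 3, 4, 5, 6, 7, 8, 9}"
  by (simp_all add: theta_def)

lemma theta_ends: "ends theta e =
  (if e < 4 then {0, e + 2} else if e < 8 then {e - 2, e + 2} else {e - 2, 1})"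
  by (simp add: theta_def)

lemma theta_bipartition: "bipartition theta {0, 6, 7, 8, 9} {1, 2, 3, 4, 5}"
proof -
  have "{0, 6, 7, 8, 9} \<union> {1, 2, 3, 4, 5} = verts theta"
    unfolding theta_verts by (simp add: insert_commute)
  moreover have "\<forall>e\<in>edges theta. \<exists>a\<in>{0, 6, 7, 8, 9}. \<exists>b\<in>{1, 2, 3, 4, 5}. ends theta e = {a, b}"
    unfolding theta_edges theta_ends by (simp add: doubleton_eq_iff)
  moreover have "{0, 6, 7, 8, 9} \<inter> {1, 2, 3, 4, 5::nat} = {}" by simp
  ultimately show ?thesis unfolding bipartition_def by (intro conjI)
qed

lemma theta_bipartite: "bipartite theta"
  using theta_bipartition by (rule bipartition_imp_bipartite)

lemma theta_multigraph: "multigraph theta"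
  unfolding multigraph_def theta_edges theta_verts theta_ends by simp

lemma card_filter_sum:
  assumes "finite S"
  shows "card {e \<in> S. P e} = (\<Sum>e\<in>S. of_bool (P e))"
  using assms by (simp add: of_bool_def sum.If_cases Int_def conj_commute)

lemma theta_V2: "V2 theta = {2, 3, 4, 5, 6, 7, 8, 9}" (is "_ = ?S")
proof -
  have "degree theta v = 2 \<longleftrightarrow> v \<in> ?S" if "v \<in> verts theta" for v
  proof -
    have "degree theta v = (\<Sum>e\<in>edges theta. of_bool (v \<in> ends theta e))"
      unfolding degree_def by (rule card_filter_sum) (simp add: theta_edges)
    with that show ?thesis
      unfolding theta_verts theta_edges theta_ends by (elim insertE emptyE) simp_all
  qed
  then have "V2 theta = verts theta \<inter> ?S" unfolding V2_def by blast
  also have "\<dots> = ?S" unfolding theta_verts by (rule Int_absorb1) simp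
  finally show ?thesis .
qed

text \<open>Unique incidence is replaced by a sum that simplification can evaluate on concrete edge
  sets.\<close>

lemma perfect_matchingI:
  assumes "finite M" "M \<subseteq> edges G" "\<forall>v\<in>verts G. (\<Sum>e\<in>M. of_bool (v \<in> ends G e)) = (1::nat)"
  shows "perfect_matching G M"
  unfolding perfect_matching_def
proof (intro conjI ballI assms(2))
  fix v assume "v \<in> verts G"
  then have "card {e \<in> M. v \<in> ends G e} = 1" using assms card_filter_sum by metis
  then obtain e where "{e \<in> M. v \<in> ends G e} = {e}" by (rule card_1_singletonE)
  then have "e' \<in> M \<and> v \<in> ends G e' \<longleftrightarrow> e' = e" for e' by blast
  then show "\<exists>!e. e \<in> M \<and> v \<in> ends G e" by simp
qed

text \<open>Each matching takes both end edges of one path and the middle edges of the other three.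
  Together the four contain every edge.\<close>

lemma theta_perfect_matchings:
  "perfect_matching theta {0, 8, 5, 6, 7}" "perfect_matching theta {1, 9, 4, 6, 7}"
  "perfect_matching theta {2, 10, 4, 5, 7}" "perfect_matching theta {3, 11, 4, 5, 6}"
  by (rule perfect_matchingI; simp add: theta_edges theta_verts theta_ends)+

lemma theta_connected: "connected_graph theta"
proof -
  have sym: "sym (adj theta)" by (auto simp: sym_def adj_def insert_commute)
  have arc: "(u, v) \<in> adj theta" if "e \<in> edges theta" "ends theta e = {u, v}" for e u v
    using that by (auto simp: adj_def)
  have x: "(0, e + 2) \<in> (adj theta)\<^sup>*" if "e < 4" for e
    using that by (intro r_into_rtrancl arc[of e]) (auto simp: theta_def)
  have y: "(0, e + 6) \<in> (adj theta)\<^sup>*" if "e < 4" for e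
    using that by (intro rtrancl_into_rtrancl[OF x[of e]] arc[of "e + 4"]) (auto simp: theta_def)
  have one: "(0, 1) \<in> (adj theta)\<^sup>*"
    by (intro rtrancl_into_rtrancl[OF y[of 0]] arc[of 8]) (auto simp: theta_def)
  have reach: "(0, v) \<in> (adj theta)\<^sup>*" if "v \<in> verts theta" for v
  proof -
    have "v = 0 \<or> v = 1 \<or> (\<exists>e<4. v = e + 2) \<or> (\<exists>e<4. v = e + 6)"
    proof -
      have "v < 10" using that unfolding theta_verts by (elim insertE emptyE) simp_all
      then show ?thesis by presburger
    qed
    then show ?thesis using x y one by auto
  qed
  have "(u, v) \<in> (adj theta)\<^sup>*" if "u \<in> verts theta" "v \<in> verts theta" for u v
  proof -
    have "(u, 0) \<in> (adj theta)\<^sup>*"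
      by (rule symD[OF sym_rtrancl[OF sym]]) (rule that(1)[THEN reach])
    then show ?thesis using reach[OF that(2)] by (rule rtrancl_trans)
  qed
  then show ?thesis by (simp add: connected_graph_def theta_verts)
qed

lemma theta_matching_covered: "matching_covered theta"
  unfolding matching_covered_def
proof (intro conjI theta_multigraph theta_connected ballI)
  show "4 \<le> card (verts theta)" by (simp add: theta_verts)
  fix e assume e: "e \<in> edges theta"
  then have "e \<in> {0, 8, 5, 6, 7} \<or> e \<in> {1, 9, 4, 6, 7} \<or> e \<in> {2, 10, 4, 5, 7} \<or> e \<in> {3, 11, 4, 5, 6}"
    unfolding theta_edges by (elim insertE emptyE) simp_all
  then show "\<exists>M. perfect_matching theta M \<and> e \<in> M" using theta_perfect_matchings by metis
qed

lemma theta_minimal: "minimal_matching_covered theta"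
proof (rule minimal_if_degree2_end[OF theta_matching_covered theta_bipartite])
  fix e assume "e \<in> edges theta"
  then have "\<exists>v\<in>ends theta e. v \<in> V2 theta"
    unfolding theta_edges theta_V2 theta_ends by auto
  then show "\<exists>v\<in>ends theta e. degree theta v = 2" by (auto simp: V2_def)
qed

theorem corollary7p2: "class_H3 \<subset> class_H2"
proof
  show "class_H3 \<subseteq> class_H2"
    unfolding class_H3_def class_H2_def quotient_def using n_extremal_imp_extremal by blast
  have "iso_rel `` {theta} \<in> class_H2"
    unfolding class_H2_def
    using theta_minimal theta_bipartite
    by (intro quotientI) (simp add: two_vertex_extremal_def theta_V2 theta_edges theta_verts)
  moreover have "iso_rel `` {theta} \<notin> class_H3"
  proof
    assume "iso_rel `` {theta} \<in> class_H3"
    \<comment> \<open>Only the numbers of vertices and edges are carried over from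
      \<open>theta\<close> to the representative \<open>G\<close>. As \<open>G\<close> is also
      extremal by the first part, \<open>V2 G\<close> would have both 8 and 7 elements.\<close>
    then obtain G where G: "minimal_matching_covered G" "bipartite G" "two_vertex_n_extremal G"
      and eq: "iso_rel `` {theta} = iso_rel `` {G}"
      unfolding class_H3_def by (auto elim!: quotientE)
    have "(theta, theta) \<in> iso_rel"
      using equiv_class_self[OF equiv_iso_rel, of theta] theta_multigraph by simp
    then have "isomorphic G theta" using eq by (auto simp: iso_rel_def)
    then have "card (verts G) = 10" "card (edges G) = 12"
      by (auto simp: theta_verts theta_edges elim!: isomorphicE dest!: bij_betw_same_card)
    then show False
      using G n_extremal_imp_extremal[OF G]
      by (simp add: two_vertex_extremal_def two_vertex_n_extremal_def)
  qed
  ultimately show "class_H3 \<noteq> class_H2" by blast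
qed

end
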